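(* Let $G$ be a tangle and let $p\in G$. Let $A\in NC^{*}(G)$ with $p\notin A$. Then there exists a continuous map $\alpha:[0,1]\to NC^{*}(G)$ such that $\alpha(0)=A$, $\alpha(1)=G$, and $p\notin B$ for every $B\in \alpha([0,1])\setminus\{G\}$.
   Context: A continuum is a compact connected metric space with more than one point. A subcontinuum of $X$ is a nonempty closed connected subset of $X$ (one-point sets are allowed). $C(X)$ denotes the hyperspace of all subcontinua of $X$, endowed with the Hausdorff metric. $NC^{*}(X)=\{A\in C(X): X\setminus A \text{ is connected}\}$, with the subspace topology from $C(X)$. The empty set counts as connected, so $X\in NC^{*}(X)$. A finite graph is a continuum that can be written as a finite union of arcs any two of which have finite intersection. A cut-point of a finite graph $G$ is a point $p\in G$ such that $G\setminus\{p\}$ is not connected. A tangle is a finite graph without cut-points (for example, a simple closed curve). *)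

theory Defs
  imports "HOL-Analysis.Analysis"
begin

definition hausdorff_dist :: "'a::metric_space set \<Rightarrow> 'a set \<Rightarrow> real" where
  "hausdorff_dist A B = max (SUP a\<in>A. infdist a B) (SUP b\<in>B. infdist b A)"

definition continuum :: "'a::metric_space set \<Rightarrow> bool" where
  "continuum X \<longleftrightarrow> compact X \<and> connected X \<and> (\<exists>x\<in>X. \<exists>y\<in>X. x \<noteq> y)"

definition is_arc :: "'a::metric_space set \<Rightarrow> bool" where
  "is_arc S \<longleftrightarrow> (\<exists>g. arc g \<and> path_image g = S)"

definition finite_graph :: "'a::metric_space set \<Rightarrow> bool" where
  "finite_graph G \<longleftrightarrow> continuum G \<and>
     (\<exists>\<A>. finite \<A> \<and> (\<forall>S\<in>\<A>. is_arc S) \<and> \<Union>\<A> = G \<and>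
          (\<forall>S\<in>\<A>. \<forall>T\<in>\<A>. S \<noteq> T \<longrightarrow> finite (S \<inter> T)))"

definition cut_point :: "'a::metric_space set \<Rightarrow> 'a \<Rightarrow> bool" where
  "cut_point G p \<longleftrightarrow> p \<in> G \<and> \<not> connected (G - {p})"

definition tangle :: "'a::metric_space set \<Rightarrow> bool" where
  "tangle G \<longleftrightarrow> finite_graph G \<and> (\<forall>p\<in>G. \<not> cut_point G p)"

definition subcontinua :: "'a::metric_space set \<Rightarrow> 'a set set" where
  "subcontinua X = {A. A \<subseteq> X \<and> A \<noteq> {} \<and> closed A \<and> connected A}"

definition NCstar :: "'a::metric_space set \<Rightarrow> 'a set set" where
  "NCstar X = {A \<in> subcontinua X. connected (X - A)}"

definition hausdorff_continuous_on :: "real set \<Rightarrow> (real \<Rightarrow> 'a::metric_space set) \<Rightarrow> bool" where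
  "hausdorff_continuous_on S \<alpha> \<longleftrightarrow>
     (\<forall>t\<in>S. \<forall>e>0. \<exists>d>0. \<forall>s\<in>S. \<bar>s - t\<bar> < d \<longrightarrow> hausdorff_dist (\<alpha> s) (\<alpha> t) < e)"

end

theory Submission
  imports Defs
begin

text \<open>
  This is a continuous version of the st-numbering of a 2-connected graph. Choose a finite vertex set
  that contains p and a point of A. The sets B on the way from A to G always meet an edge in a segment
  starting at an endpoint in B, because B and its complement are both connected. One absorbs a vertex
  v into B by pushing forward, simultaneously and at the same speed, along all edges that lead from B
  to v; until v is reached the complement stays connected, and it stays so afterwards if v is chosen
  well. A good v other than p exists as long as p is not the only vertex left, because G has no
  cut-points. At the end p itself is absorbed in the same way, and B becomes G.
\<close>

text \<open>The edges from \<open>B\<close> to \<open>v\<close> have to arrive at \<open>v\<close>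
  together. If only one of them were filled, the rest of a second one would be an open segment with
  both ends in the grown set: for \<open>v\<close> other than \<open>p\<close> it would be cut off
  from \<open>p\<close>, and for \<open>v = p\<close> the set would already contain \<open>p\<close>
  without being \<open>G\<close>. A vertex inside \<open>A\<close> is required because a connected
  set without vertices may sit in the middle of an edge and meet it in a segment that contains
  neither endpoint. The absence of cut-points forces every piece that \<open>v\<close> separates
  within the complement of \<open>B\<close> to be joined to \<open>B\<close> by an edge of its own.
  A piece hanging on \<open>v\<close> alone could neither be entered before \<open>v\<close> nor
  stay connected to \<open>p\<close> after it.\<close>

section \<open>Cutting an arc at finitely many points\<close>

text \<open>The inclusion of the open pieces in the open arc serves the induction below: it keeps
  the pieces of the two halves of a cut arc apart.\<close>

definition subdivides :: "'a::metric_space set \<Rightarrow> (real \<Rightarrow> 'a) set \<Rightarrow> (real \<Rightarrow> 'a) \<Rightarrow> bool" where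
  "subdivides F E g \<longleftrightarrow> finite E \<and> (\<Union>e\<in>E. path_image e) = path_image g \<and>
     (\<forall>e\<in>E. arc e \<and> e 0 \<in> F \<and> e 1 \<in> F \<and> e ` {0<..<1} \<inter> F = {} \<and> e ` {0<..<1} \<subseteq> g ` {0<..<1}) \<and>
     (\<forall>e\<in>E. \<forall>e'\<in>E. e \<noteq> e' \<longrightarrow> e ` {0<..<1} \<inter> e' ` {0<..<1} = {})"

lemma subdividesD:
  assumes "subdivides F E g"
  shows "finite E" "(\<Union>e\<in>E. path_image e) = path_image g"
    and "e \<in> E \<Longrightarrow> arc e" "e \<in> E \<Longrightarrow> e 0 \<in> F" "e \<in> E \<Longrightarrow> e 1 \<in> F"
    and "e \<in> E \<Longrightarrow> e ` {0<..<1} \<inter> F = {}" "e \<in> E \<Longrightarrow> e ` {0<..<1} \<subseteq> g ` {0<..<1}"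
    and "e \<in> E \<Longrightarrow> e' \<in> E \<Longrightarrow> e \<noteq> e' \<Longrightarrow> e ` {0<..<1} \<inter> e' ` {0<..<1} = {}"
  using assms by (simp_all add: subdivides_def)

lemma arc_reparam_segment:
  fixes g :: "real \<Rightarrow> 'a::metric_space"
  assumes "arc g" "0 \<le> a" "a < b" "b \<le> 1"
  shows "arc (\<lambda>x. g (a + (b - a) * x))" (is ?arc)
    and "(\<lambda>x. g (a + (b - a) * x)) ` {0<..<1} = g ` {a<..<b}" (is ?open)
    and "path_image (\<lambda>x. g (a + (b - a) * x)) = g ` {a..b}" (is ?closed)
proof -
  let ?l = "\<lambda>x. a + (b - a) * x"
  have l: "?l ` {0..1} = {a..b}"
  proof -
    have "(+) a ` (*) (b - a) ` {0..1} = {a..b}"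
      using assms by (simp add: image_mult_atLeastAtMost)
    then show ?thesis by (simp add: image_image)
  qed
  have lo: "?l ` {0<..<1} = {a<..<b}"
  proof (intro equalityI subsetI)
    fix y assume "y \<in> ?l ` {0<..<1}"
    then obtain x where x: "0 < x" "x < 1" "y = ?l x" by auto
    then have "0 < (b - a) * x" "0 < (b - a) * (1 - x)" using assms by simp_all
    moreover have "(b - a) * (1 - x) = b - ?l x" by (simp add: algebra_simps)
    ultimately show "y \<in> {a<..<b}" using x by simp
  next
    fix y assume y: "y \<in> {a<..<b}"
    then have "y = ?l ((y - a) / (b - a))" "(y - a) / (b - a) \<in> {0<..<1}"
      using assms by auto
    then show "y \<in> ?l ` {0<..<1}" by blast
  qed
  have sub: "{a..b} \<subseteq> {0..1}" using assms by auto
  have "continuous_on {0..1} (g \<circ> ?l)"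
    using assms sub l
    by (intro continuous_on_compose continuous_intros)
       (metis arc_def continuous_on_subset path_def)
  moreover have "inj_on (g \<circ> ?l) {0..1}"
  proof (rule comp_inj_on)
    show "inj_on ?l {0..1}" using assms by (auto simp: inj_on_def)
    show "inj_on g (?l ` {0..1})"
      using assms(1) sub unfolding l arc_def by (meson inj_on_subset)
  qed
  ultimately show ?arc by (simp add: arc_def path_def o_def)
  show ?open using lo by (metis (no_types, lifting) image_cong image_image)
  show ?closed unfolding path_image_def using l by (metis (no_types, lifting) image_cong image_image)
qed

text \<open>The arc is cut at an interior point of \<open>F\<close>. By injectivity that point lies
  in neither open half, so both halves have fewer points of \<open>F\<close> inside.\<close>

lemma subdivides_exists:
  fixes g :: "real \<Rightarrow> 'a::metric_space"
  assumes "arc g" "finite F" "g 0 \<in> F" "g 1 \<in> F"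
  shows "\<exists>E. subdivides F E g"
  using assms
proof (induction "card (g ` {0<..<1} \<inter> F)" arbitrary: g rule: less_induct)
  case less
  note inj = \<open>arc g\<close>[THEN arc_imp_inj_on]
  show ?case
  proof (cases "g ` {0<..<1} \<inter> F = {}")
    case True
    then have "subdivides F {g} g" using less.prems by (auto simp: subdivides_def)
    then show ?thesis by blast
  next
    case False
    then obtain c where c: "0 < c" "c < 1" "g c \<in> F" by auto
    let ?g1 = "\<lambda>x. g (0 + (c - 0) * x)" and ?g2 = "\<lambda>x. g (c + (1 - c) * x)"
    have r1: "arc ?g1" "?g1 ` {0<..<1} = g ` {0<..<c}" "path_image ?g1 = g ` {0..c}"
      using arc_reparam_segment[OF \<open>arc g\<close>, of 0 c] c by auto
    have r2: "arc ?g2" "?g2 ` {0<..<1} = g ` {c<..<1}" "path_image ?g2 = g ` {c..1}"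
      using arc_reparam_segment[OF \<open>arc g\<close>, of c 1] c by auto
    have "g c \<notin> g ` {0<..<c}" "g c \<notin> g ` {c<..<1}"
      using c inj by (auto dest: inj_onD)
    moreover have sub: "g ` {0<..<c} \<subseteq> g ` {0<..<1}" "g ` {c<..<1} \<subseteq> g ` {0<..<1}"
      using c by auto
    moreover have "g c \<in> g ` {0<..<1} \<inter> F" using c by auto
    ultimately have "g ` {0<..<c} \<inter> F \<subset> g ` {0<..<1} \<inter> F"
        "g ` {c<..<1} \<inter> F \<subset> g ` {0<..<1} \<inter> F" by blast+
    then have "card (g ` {0<..<c} \<inter> F) < card (g ` {0<..<1} \<inter> F)"
        "card (g ` {c<..<1} \<inter> F) < card (g ` {0<..<1} \<inter> F)"
      using \<open>finite F\<close> by (meson finite_Int psubset_card_mono)+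
    then obtain E1 E2 where E: "subdivides F E1 ?g1" "subdivides F E2 ?g2"
      using less.hyps[of ?g1] less.hyps[of ?g2] r1 r2 less.prems c by auto
    have dis: "g ` {0<..<c} \<inter> g ` {c<..<1} = {}"
      using c inj by (force dest: inj_onD)
    have "{0..1} = {0..c} \<union> {c..1}" using c by auto
    then have un: "path_image g = g ` {0..c} \<union> g ` {c..1}" by (simp add: path_image_def image_Un)
    have "subdivides F (E1 \<union> E2) g"
      unfolding subdivides_def
    proof (intro conjI ballI impI)
      show "finite (E1 \<union> E2)" using E by (simp add: subdivides_def)
      show "(\<Union>e\<in>E1 \<union> E2. path_image e) = path_image g"
        using E r1 r2 un by (simp add: subdivides_def UN_Un)
      have int1: "e ` {0<..<1} \<subseteq> g ` {0<..<c}" if "e \<in> E1" for e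
        using subdividesD(7)[OF E(1) that] r1 by simp
      have int2: "e ` {0<..<1} \<subseteq> g ` {c<..<1}" if "e \<in> E2" for e
        using subdividesD(7)[OF E(2) that] r2 by simp
      fix e assume e: "e \<in> E1 \<union> E2"
      then show "arc e" "e 0 \<in> F" "e 1 \<in> F" "e ` {0<..<1} \<inter> F = {}"
        by (elim UnE; simp add: subdividesD(3-6)[OF E(1)] subdividesD(3-6)[OF E(2)])+
      show "e ` {0<..<1} \<subseteq> g ` {0<..<1}" using e int1 int2 sub by blast
      fix e' assume e': "e' \<in> E1 \<union> E2" "e \<noteq> e'"
      have "e ` {0<..<1} \<inter> e' ` {0<..<1} = {}" if "e \<in> E1" "e' \<in> E1"
        by (rule subdividesD(8)[OF E(1) that e'(2)])
      moreover have "e ` {0<..<1} \<inter> e' ` {0<..<1} = {}" if "e \<in> E2" "e' \<in> E2"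
        by (rule subdividesD(8)[OF E(2) that e'(2)])
      moreover have "e ` {0<..<1} \<inter> e' ` {0<..<1} = {}" if "e \<in> E1" "e' \<in> E2"
        using int1[OF that(1)] int2[OF that(2)] dis by blast
      moreover have "e ` {0<..<1} \<inter> e' ` {0<..<1} = {}" if "e \<in> E2" "e' \<in> E1"
        using int1[OF that(2)] int2[OF that(1)] dis by blast
      ultimately show "e ` {0<..<1} \<inter> e' ` {0<..<1} = {}" using e e' by blast
    qed
    then show ?thesis by blast
  qed
qed

section \<open>Finite graphs as vertices and doubly oriented edges\<close>

lemma reversepath_image_open_interval: "reversepath e ` {0<..<1} = e ` {0<..<1}"
proof -
  have "(\<lambda>x::real. 1 - x) ` {0<..<1} = {0<..<1}"
    by (force simp: image_iff intro: bexI[of _ "1 - _"])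
  then show ?thesis unfolding reversepath_def by (metis (no_types, lifting) image_cong image_image)
qed

text \<open>Every edge is listed in both orientations, so that an edge joining two given vertices can
  always be taken to run from the first to the second.\<close>

locale graph_decomposition =
  fixes G V :: "'a::metric_space set" and E :: "(real \<Rightarrow> 'a) set"
  assumes finite_V: "finite V" and finite_E: "finite E" and V_subset: "V \<subseteq> G"
    and arc_edge: "e \<in> E \<Longrightarrow> arc e"
    and reversepath_edge: "e \<in> E \<Longrightarrow> reversepath e \<in> E"
    and edge_start: "e \<in> E \<Longrightarrow> e 0 \<in> V"
    and edge_interior: "e \<in> E \<Longrightarrow> e ` {0<..<1} \<inter> V = {}"
    and edges_disjoint: "e \<in> E \<Longrightarrow> e' \<in> E \<Longrightarrow> e ` {0<..<1} \<inter> e' ` {0<..<1} \<noteq> {} \<Longrightarrow>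
           e' = e \<or> e' = reversepath e"
    and edges_cover: "(\<Union>e\<in>E. path_image e) = G"

lemma finite_graph_decomposition:
  fixes G :: "'a::metric_space set"
  assumes "finite_graph G" "finite P" "P \<subseteq> G"
  obtains V E where "graph_decomposition G V E" "P \<subseteq> V"
proof -
  obtain \<A> where \<A>: "finite \<A>" "\<forall>S\<in>\<A>. is_arc S" "\<Union>\<A> = G"
      "\<forall>S\<in>\<A>. \<forall>T\<in>\<A>. S \<noteq> T \<longrightarrow> finite (S \<inter> T)"
    using assms by (auto simp: finite_graph_def)
  then obtain g where g: "\<And>S. S \<in> \<A> \<Longrightarrow> arc (g S) \<and> path_image (g S) = S"
    unfolding is_arc_def by metis
  \<comment> \<open>The pairwise intersections are finite by the definition of a finite graph. With
    them in \<open>V\<close>, pieces of different arcs can overlap only in vertices, so their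
    interiors are disjoint.\<close>
  define V where "V = P \<union> (\<lambda>S. g S 0) ` \<A> \<union> (\<lambda>S. g S 1) ` \<A> \<union>
     (\<Union>S\<in>\<A>. \<Union>T\<in>\<A> - {S}. S \<inter> T)"
  have "finite (\<Union>T\<in>\<A> - {S}. S \<inter> T)" if "S \<in> \<A>" for S
    using \<A>(1,4) that by (intro finite_UN_I) auto
  then have finV: "finite V" using \<A>(1) assms(2) unfolding V_def by blast
  have "\<exists>E. subdivides V E (g S)" if "S \<in> \<A>" for S
    using subdivides_exists[of "g S" V] g finV that by (auto simp: V_def)
  then obtain D where D: "\<And>S. S \<in> \<A> \<Longrightarrow> subdivides V (D S) (g S)" by metis
  have DD: "arc e" "e 0 \<in> V" "e 1 \<in> V" "e ` {0<..<1} \<inter> V = {}" "path_image e \<subseteq> S"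
    if "S \<in> \<A>" "e \<in> D S" for e S
    using subdividesD(2)[OF D[OF that(1)]] subdividesD(3-6)[OF D[OF that(1)] that(2)] that g[OF that(1)]
    by auto
  define E where "E = (\<Union>S\<in>\<A>. D S) \<union> reversepath ` (\<Union>S\<in>\<A>. D S)"
  have dis: "e ` {0<..<1} \<inter> e' ` {0<..<1} = {}"
    if S: "S \<in> \<A>" "S' \<in> \<A>" and e: "e \<in> D S" "e' \<in> D S'" and ne: "e \<noteq> e'" for e e' S S'
  proof (cases "S = S'")
    case True
    then show ?thesis using subdividesD(8)[OF D[OF S(1)]] e ne by simp
  next
    case False
    have "e ` {0<..<1} \<subseteq> path_image e" "e' ` {0<..<1} \<subseteq> path_image e'"
      by (auto simp: path_image_def)
    then have "e ` {0<..<1} \<inter> e' ` {0<..<1} \<subseteq> S \<inter> S'" using DD(5) S e by blast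
    also have "\<dots> \<subseteq> V" using False S unfolding V_def by blast
    finally show ?thesis using DD(4)[OF S(1) e(1)] by blast
  qed
  have "graph_decomposition G V E"
  proof
    show "finite V" by fact
    have finD: "finite (\<Union>S\<in>\<A>. D S)" using D \<A> by (auto simp: subdivides_def)
    then show "finite E" by (simp add: E_def)
    have "g S 0 \<in> S \<and> g S 1 \<in> S" if "S \<in> \<A>" for S
      using g[OF that] unfolding path_image_def by (metis atLeastAtMost_iff image_eqI order_refl zero_le_one)
    then show "V \<subseteq> G" using assms \<A>(3) unfolding V_def by blast
    have "(\<Union>e\<in>D S. path_image e) = S" if "S \<in> \<A>" for S
      using D[OF that] g[OF that] by (simp add: subdivides_def)
    then have "(\<Union>e\<in>(\<Union>S\<in>\<A>. D S). path_image e) = G" using \<A>(3) by auto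
    then show "(\<Union>e\<in>E. path_image e) = G" by (simp add: E_def UN_Un)
  next
    fix e assume "e \<in> E"
    then consider S where "S \<in> \<A>" "e \<in> D S" | S e0 where "S \<in> \<A>" "e0 \<in> D S" "e = reversepath e0"
      unfolding E_def by blast
    note ecases = this
    show "arc e" by (cases rule: ecases) (use DD in \<open>auto intro: arc_reversepath\<close>)
    show "reversepath e \<in> E" by (cases rule: ecases) (auto simp: E_def)
    show "e 0 \<in> V" by (cases rule: ecases) (use DD in \<open>auto simp: reversepath_def\<close>)
    show "e ` {0<..<1} \<inter> V = {}"
      by (cases rule: ecases) (use DD reversepath_image_open_interval in metis)+
  next
    fix e e' assume e: "e \<in> E" "e' \<in> E" "e ` {0<..<1} \<inter> e' ` {0<..<1} \<noteq> {}"
    obtain S d where d: "S \<in> \<A>" "d \<in> D S" "e = d \<or> e = reversepath d"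
      using e(1) unfolding E_def by blast
    obtain S' d' where d': "S' \<in> \<A>" "d' \<in> D S'" "e' = d' \<or> e' = reversepath d'"
      using e(2) unfolding E_def by blast
    have "e ` {0<..<1} = d ` {0<..<1}" "e' ` {0<..<1} = d' ` {0<..<1}"
      using d d' reversepath_image_open_interval by metis+
    then have "d = d'" using dis d d' e by metis
    then show "e' = e \<or> e' = reversepath e" using d d' by auto
  qed
  moreover have "P \<subseteq> V" by (auto simp: V_def)
  ultimately show thesis using that by blast
qed


section \<open>Clopen pieces, Hausdorff distance and concatenation of paths\<close>

lemma connected_subset_clopen:
  assumes "connected C" "C \<subseteq> Y" "C \<inter> X \<noteq> {}"
    and "openin (top_of_set Y) X" "closedin (top_of_set Y) X"
  shows "C \<subseteq> X"
proof -
  obtain S T where "open S" "X = Y \<inter> S" "closed T" "X = Y \<inter> T"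
    using assms(4,5) by (auto simp: openin_open closedin_closed)
  then have "C \<inter> X = C \<inter> S" "C \<inter> X = C \<inter> T" using assms(2) by blast+
  then have "openin (top_of_set C) (C \<inter> X)" "closedin (top_of_set C) (C \<inter> X)"
    using \<open>open S\<close> \<open>closed T\<close> by (simp add: openin_open_Int, metis closedin_closed_Int)
  then have "C \<inter> X = C" using assms(1,3) unfolding connected_clopen by blast
  then show ?thesis by blast
qed

lemma hausdorff_dist_le:
  assumes "A \<noteq> {}" "B \<noteq> {}"
    and "\<And>a. a \<in> A \<Longrightarrow> \<exists>b\<in>B. dist a b \<le> r" "\<And>b. b \<in> B \<Longrightarrow> \<exists>a\<in>A. dist b a \<le> r"
  shows "hausdorff_dist A B \<le> r"
  unfolding hausdorff_dist_def
proof (rule max.boundedI)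
  show "(SUP a\<in>A. infdist a B) \<le> r" using assms(1,3) by (intro cSUP_least) (meson infdist_le2)+
  show "(SUP b\<in>B. infdist b A) \<le> r" using assms(2,4) by (intro cSUP_least) (meson infdist_le2)+
qed

lemma hausdorff_continuous_on_join:
  assumes \<alpha>: "hausdorff_continuous_on {0..1} \<alpha>" and \<beta>: "hausdorff_continuous_on {0..1} \<beta>"
    and eq: "\<alpha> 1 = \<beta> 0"
  shows "hausdorff_continuous_on {0..1} (\<lambda>t. if t \<le> 1/2 then \<alpha> (2 * t) else \<beta> (2 * t - 1))"
    (is "hausdorff_continuous_on _ ?\<gamma>")
  unfolding hausdorff_continuous_on_def
proof (intro ballI allI impI)
  fix t \<epsilon> :: real assume t: "t \<in> {0..1}" and \<epsilon>: "\<epsilon> > 0"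
  have \<gamma>2: "?\<gamma> s = \<beta> (2 * s - 1)" if "s \<ge> 1/2" for s
    by (cases "s = 1/2") (use that eq in \<open>simp_all only: split: if_split\<close>, simp_all)
  have left: "\<exists>d>0. \<forall>s\<in>{0..1/2}. \<bar>s - t\<bar> < d \<longrightarrow> hausdorff_dist (?\<gamma> s) (?\<gamma> t) < \<epsilon>"
  proof (cases "t \<le> 1/2")
    case True
    then have "2 * t \<in> {0..1}" using t by auto
    then obtain d where d: "d > 0"
        "\<And>s. s \<in> {0..1} \<Longrightarrow> \<bar>s - 2 * t\<bar> < d \<Longrightarrow> hausdorff_dist (\<alpha> s) (\<alpha> (2 * t)) < \<epsilon>"
      using \<alpha> \<epsilon> unfolding hausdorff_continuous_on_def by blast
    have "hausdorff_dist (?\<gamma> s) (?\<gamma> t) < \<epsilon>" if "s \<in> {0..1/2}" "\<bar>s - t\<bar> < d/2" for s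
    proof -
      have "\<bar>2 * s - 2 * t\<bar> < d" using that(2) by linarith
      then show ?thesis using d(2)[of "2 * s"] that True by simp
    qed
    then show ?thesis using d(1) by (intro exI[of _ "d/2"]) auto
  next
    case False
    \<comment> \<open>Here \<open>t\<close> lies in the right half, and no point of the left half is
      closer to it than \<open>t - 1/2\<close>: the condition holds vacuously.\<close>
    then show ?thesis by (intro exI[of _ "t - 1/2"]) (auto simp: abs_less_iff)
  qed
  have right: "\<exists>d>0. \<forall>s\<in>{1/2..1}. \<bar>s - t\<bar> < d \<longrightarrow> hausdorff_dist (?\<gamma> s) (?\<gamma> t) < \<epsilon>"
  proof (cases "t \<ge> 1/2")
    case True
    then have "2 * t - 1 \<in> {0..1}" using t by auto
    then obtain d where d: "d > 0"
        "\<And>s. s \<in> {0..1} \<Longrightarrow> \<bar>s - (2 * t - 1)\<bar> < d \<Longrightarrow> hausdorff_dist (\<beta> s) (\<beta> (2 * t - 1)) < \<epsilon>"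
      using \<beta> \<epsilon> unfolding hausdorff_continuous_on_def by blast
    have "hausdorff_dist (?\<gamma> s) (?\<gamma> t) < \<epsilon>" if s: "s \<in> {1/2..1}" "\<bar>s - t\<bar> < d/2" for s
    proof -
      have "\<bar>2 * s - 1 - (2 * t - 1)\<bar> < d" using s(2) by linarith
      then have "hausdorff_dist (\<beta> (2 * s - 1)) (\<beta> (2 * t - 1)) < \<epsilon>"
        using d(2)[of "2 * s - 1"] s by auto
      moreover have "s \<ge> 1/2" using s by simp
      ultimately show ?thesis by (simp only: \<gamma>2 True)
    qed
    then show ?thesis using d(1) by (intro exI[of _ "d/2"]) auto
  next
    case False
    then show ?thesis by (intro exI[of _ "1/2 - t"]) (auto simp: abs_less_iff)
  qed
  obtain d1 d2 where d: "d1 > 0" "d2 > 0"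
      "\<forall>s\<in>{0..1/2}. \<bar>s - t\<bar> < d1 \<longrightarrow> hausdorff_dist (?\<gamma> s) (?\<gamma> t) < \<epsilon>"
      "\<forall>s\<in>{1/2..1}. \<bar>s - t\<bar> < d2 \<longrightarrow> hausdorff_dist (?\<gamma> s) (?\<gamma> t) < \<epsilon>"
    using left right by blast
  have "hausdorff_dist (?\<gamma> s) (?\<gamma> t) < \<epsilon>" if "s \<in> {0..1}" "\<bar>s - t\<bar> < min d1 d2" for s
  proof (cases "s \<le> 1/2")
    case True
    then have "s \<in> {0..1/2}" using that by auto
    then show ?thesis using d(3) that by (meson min_less_iff_conj)
  next
    case False
    then have "s \<in> {1/2..1}" using that by auto
    then show ?thesis using d(4) that by (meson min_less_iff_conj)
  qed
  then show "\<exists>d>0. \<forall>s\<in>{0..1}. \<bar>s - t\<bar> < d \<longrightarrow> hausdorff_dist (?\<gamma> s) (?\<gamma> t) < \<epsilon>"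
    using d by (intro exI[of _ "min d1 d2"]) (simp del: atLeastAtMost_iff)
qed

section \<open>How connected sets meet an edge\<close>

context graph_decomposition
begin

lemma edge_end: "e \<in> E \<Longrightarrow> e 1 \<in> V"
  using edge_start[OF reversepath_edge] by (simp add: reversepath_def)

lemma continuous_on_edge: "e \<in> E \<Longrightarrow> continuous_on {0..1} e"
  using arc_edge by (simp add: arc_def path_def)

lemma edge_eq_iff: "e \<in> E \<Longrightarrow> s \<in> {0..1} \<Longrightarrow> t \<in> {0..1} \<Longrightarrow> e s = e t \<longleftrightarrow> s = t"
  using arc_edge by (meson arc_def inj_on_eq_iff)

lemma edge_in_graph: "e \<in> E \<Longrightarrow> t \<in> {0..1} \<Longrightarrow> e t \<in> G"
  using edges_cover unfolding path_image_def by blast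

lemma vertex_on_edge:
  assumes "e \<in> E" "t \<in> {0..1}" "e t \<in> V"
  shows "t = 0 \<or> t = 1"
proof (rule ccontr)
  assume "\<not> ?thesis"
  then have "t \<in> {0<..<1}" using assms by auto
  then show False using edge_interior assms by blast
qed

lemma compact_edge_segment: "e \<in> E \<Longrightarrow> 0 \<le> a \<Longrightarrow> b \<le> 1 \<Longrightarrow> compact (e ` {a..b})"
  by (intro compact_continuous_image continuous_on_subset[OF continuous_on_edge]) auto

lemma connected_edge_segment: "e \<in> E \<Longrightarrow> I \<subseteq> {0..1} \<Longrightarrow> is_interval I \<Longrightarrow> connected (e ` I)"
  by (intro connected_continuous_image continuous_on_subset[OF continuous_on_edge] is_interval_connected) auto

lemma compact_path_image_edge: "e \<in> E \<Longrightarrow> compact (path_image e)"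
  using compact_edge_segment[of e 0 1] by (simp add: path_image_def)

text \<open>The rest of \<open>G\<close> consists of the vertices, the other edges and two closed
  segments of \<open>e\<close>, a finite union of compact sets.\<close>

lemma openin_edge_segment:
  assumes e: "e \<in> E" and s: "0 \<le> s" and u: "u \<le> 1"
  shows "openin (top_of_set G) (e ` {s<..<u})"
proof -
  \<comment> \<open>The clamps \<open>min s 1\<close> and \<open>max u 0\<close> keep both segments
    inside the unit interval, since \<open>s > 1\<close> and \<open>u < 0\<close> are allowed (the
    open segment is then empty).\<close>
  define C where "C = V \<union> (\<Union>e'\<in>E - {e, reversepath e}. path_image e') \<union> e ` {0..min s 1} \<union> e ` {max u 0..1}"
  have "closed C"
    unfolding C_def using finite_V finite_E e
    by (intro closed_Un closed_UN finite_imp_closed compact_imp_closed compact_edge_segment)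
       (auto intro: compact_path_image_edge)
  moreover have "e ` {s<..<u} = G - C"
  proof (intro equalityI subsetI)
    fix x assume "x \<in> e ` {s<..<u}"
    then obtain r where r: "s < r" "r < u" "x = e r" by auto
    then have r01: "r \<in> {0..1}" "r \<in> {0<..<1}" using s u by auto
    have "x \<notin> V" using edge_interior[OF e] r r01 by blast
    moreover have "x \<notin> path_image e'" if e': "e' \<in> E - {e, reversepath e}" for e'
    proof
      assume "x \<in> path_image e'"
      then obtain q where q: "q \<in> {0..1}" "x = e' q" by (auto simp: path_image_def)
      show False
      proof (cases "q \<in> {0<..<1}")
        case True
        then have "x \<in> e ` {0<..<1} \<inter> e' ` {0<..<1}" using q r r01 by blast
        then show False using edges_disjoint[OF e, of e'] e' by blast
      next
        case False
        then have "q = 0 \<or> q = 1" using q by auto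
        then show False using q e' edge_start edge_end \<open>x \<notin> V\<close> by auto
      qed
    qed
    moreover have "x \<notin> e ` {0..min s 1} \<union> e ` {max u 0..1}"
    proof -
      have "r = q" if "x = e q" "q \<in> {0..1}" for q
        using edge_eq_iff[OF e r01(1) that(2)] that r by simp
      then show ?thesis using r r01 by fastforce
    qed
    ultimately show "x \<in> G - C" using edge_in_graph[OF e r01(1)] r unfolding C_def by blast
  next
    fix x assume x: "x \<in> G - C"
    then obtain e' where "e' \<in> E" "x \<in> path_image e'" using edges_cover by blast
    then have "x \<in> path_image e" using x unfolding C_def by auto
    then obtain q where q: "q \<in> {0..1}" "x = e q" by (auto simp: path_image_def)
    then have "q \<notin> {0..min s 1}" "q \<notin> {max u 0..1}" using x unfolding C_def by blast+
    then show "x \<in> e ` {s<..<u}" using q by auto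
  qed
  ultimately show ?thesis by (simp add: Diff_eq openin_open_Int open_Compl)
qed

text \<open>If \<open>K\<close> missed a point on each side of \<open>e t\<close>, the open and the
  closed segment between these points would have the same trace on \<open>K\<close>. This trace is
  then clopen in \<open>K\<close>, so \<open>K\<close> would lie inside the edge and contain no
  vertex. The lemma is applied both to \<open>B\<close> and to its complement.\<close>

lemma connected_edge_half:
  assumes e: "e \<in> E" and K: "connected K" "K \<subseteq> G" "K \<inter> V \<noteq> {}" and t: "t \<in> {0<..<1}" "e t \<in> K"
  shows "e ` {0..t} \<subseteq> K \<or> e ` {t..1} \<subseteq> K"
proof (rule ccontr)
  assume "\<not> ?thesis"
  then obtain s u where s: "0 \<le> s" "s \<le> t" "e s \<notin> K" and u: "t \<le> u" "u \<le> 1" "e u \<notin> K"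
    by (auto simp: image_subset_iff)
  have ne: "s \<noteq> t" "u \<noteq> t" using s u t by auto
  have "openin (top_of_set K) (K \<inter> e ` {s<..<u})"
    using openin_edge_segment[OF e s(1) u(2)] K(2)
    by (auto simp: openin_open)
  moreover have "K \<inter> e ` {s<..<u} = K \<inter> e ` {s..u}"
  proof -
    have "{s..u} = insert s (insert u {s<..<u})" using s u by auto
    then show ?thesis using s u by auto
  qed
  then have "closedin (top_of_set K) (K \<inter> e ` {s<..<u})"
    using compact_imp_closed[OF compact_edge_segment[OF e s(1) u(2)]] by (simp add: closedin_closed_Int)
  moreover have "e t \<in> K \<inter> e ` {s<..<u}" using s u t ne by auto
  ultimately have "K \<subseteq> e ` {s<..<u}" using K(1) unfolding connected_clopen by blast
  moreover have "e ` {s<..<u} \<subseteq> e ` {0<..<1}" using s u by (intro image_mono) auto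
  then have "e ` {s<..<u} \<inter> V = {}" using edge_interior[OF e] by blast
  ultimately show False using K by blast
qed

end


section \<open>The sets on the way and their growth along edges\<close>

text \<open>The vertices \<open>a\<close> and \<open>p\<close> witness that both \<open>B\<close>
  and \<open>G - B\<close> meet \<open>V\<close>, which is what \<open>connected_edge_half\<close>
  asks of a connected set. They stay fixed while \<open>B\<close> grows.\<close>

locale partial_growth = graph_decomposition G V E for G V :: "'a::metric_space set" and E +
  fixes B :: "'a set" and p a :: 'a
  assumes B: "B \<in> NCstar G" and p: "p \<in> V" "p \<notin> B" and a: "a \<in> V" "a \<in> B"
    and no_cut_points: "v \<in> G \<Longrightarrow> connected (G - {v})"
begin

lemma B_facts: "closed B" "connected B" "B \<subseteq> G" "connected (G - B)"
  using B by (auto simp: NCstar_def subcontinua_def)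

text \<open>The complement of \<open>B\<close> contains \<open>e t\<close> and the vertex
  \<open>p\<close>, so it contains one of the two parts of the edge at \<open>e t\<close>; the
  initial part contains \<open>e 0\<close>, which is in \<open>B\<close>. For \<open>s = 1\<close>
  this shows that an edge with both ends in \<open>B\<close> lies in \<open>B\<close>.\<close>

lemma leave_B:
  assumes e: "e \<in> E" "e 0 \<in> B" and t: "t \<in> {0..1}" "e t \<notin> B" and s: "s \<in> {t..1}"
  shows "e s \<notin> B"
proof (cases "t = 1 \<or> s = t")
  case True
  then show ?thesis using t s by auto
next
  case False
  have "t \<noteq> 0" using e t by auto
  then have "t \<in> {0<..<1}" using False t by auto
  moreover have "e t \<in> G - B" using edge_in_graph e t by blast
  moreover have "(G - B) \<inter> V \<noteq> {}" using p V_subset by blast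
  ultimately have "e ` {0..t} \<subseteq> G - B \<or> e ` {t..1} \<subseteq> G - B"
    using connected_edge_half[OF e(1) B_facts(4)] by blast
  moreover have "e 0 \<in> e ` {0..t}" using t by auto
  ultimately show ?thesis using e s by blast
qed

text \<open>The same argument with the roles of \<open>B\<close> and its complement exchanged; the
  vertex is now \<open>a\<close>.\<close>

lemma edge_outside_B:
  assumes e: "e \<in> E" "e 0 \<notin> B" "e 1 \<notin> B" and t: "t \<in> {0..1}"
  shows "e t \<notin> B"
proof
  assume "e t \<in> B"
  then have "t \<noteq> 0" "t \<noteq> 1" using e by auto
  then have "t \<in> {0<..<1}" using t by auto
  then have "e ` {0..t} \<subseteq> B \<or> e ` {t..1} \<subseteq> B"
    using connected_edge_half[OF e(1) B_facts(2,3)] a \<open>e t \<in> B\<close> by blast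
  moreover have "e 0 \<in> e ` {0..t}" "e 1 \<in> e ` {t..1}" using t by auto
  ultimately show False using e by blast
qed

definition attaching :: "'a \<Rightarrow> (real \<Rightarrow> 'a) set" where
  "attaching v = {h \<in> E. h 0 \<in> B \<and> h 1 = v}"

text \<open>The clock is the parameter of the edge, not the distance from the boundary of
  \<open>B\<close>. The part of an edge that is already in \<open>B\<close> is run through without
  effect, and every attaching edge reaches \<open>v\<close> exactly at time 1.\<close>

definition grow :: "'a \<Rightarrow> real \<Rightarrow> 'a set" where
  "grow v t = B \<union> (\<Union>h\<in>attaching v. h ` {0..t})"

lemma attachingD: "h \<in> attaching v \<Longrightarrow> h \<in> E" "h \<in> attaching v \<Longrightarrow> h 0 \<in> B" "h \<in> attaching v \<Longrightarrow> h 1 = v"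
  by (auto simp: attaching_def)

lemma finite_attaching: "finite (attaching v)"
  using finite_E by (simp add: attaching_def)

lemma grow_0: "grow v 0 = B"
  by (auto simp: grow_def attaching_def)

lemma grow_subcontinuum:
  assumes "t \<in> {0..1}"
  shows "grow v t \<in> subcontinua G"
proof -
  have "closed (grow v t)"
    unfolding grow_def using assms finite_attaching B_facts(1)
    by (intro closed_Un closed_UN ballI compact_imp_closed[OF compact_edge_segment]) (auto dest: attachingD)
  moreover have "h ` {0..t} \<subseteq> G" if "h \<in> attaching v" for h
    using edge_in_graph[OF attachingD(1)[OF that]] assms by auto
  then have "grow v t \<subseteq> G" using B_facts(3) unfolding grow_def by blast
  moreover have "connected (grow v t)"
  proof -
    have "connected (B \<union> h ` {0..t})" if "h \<in> attaching v" for h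
    proof (rule connected_Un)
      show "connected (h ` {0..t})"
        using assms that by (intro connected_edge_segment) (auto dest: attachingD simp: is_interval_cc)
      have "h 0 \<in> h ` {0..t}" using assms by auto
      then show "B \<inter> h ` {0..t} \<noteq> {}" using that attachingD(2) by blast
    qed (rule B_facts)
    \<comment> \<open>\<open>B\<close> is inserted as a member of its own to cover the case that no
      edge attaches.\<close>
    then have "connected (\<Union> (insert B ((\<lambda>h. B \<union> h ` {0..t}) ` attaching v)))"
      using B_facts(2) a by (intro connected_Union) auto
    moreover have "\<Union> (insert B ((\<lambda>h. B \<union> h ` {0..t}) ` attaching v)) = grow v t"
      by (auto simp: grow_def)
    ultimately show ?thesis by simp
  qed
  moreover have "grow v t \<noteq> {}" using a by (auto simp: grow_def)
  ultimately show ?thesis by (simp add: subcontinua_def)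
qed

lemma vertex_in_grow:
  assumes "x \<in> V" "x \<noteq> v" "t \<in> {0..1}"
  shows "x \<in> grow v t \<longleftrightarrow> x \<in> B"
proof -
  have "x \<in> B" if h: "h \<in> attaching v" "r \<in> {0..t}" "x = h r" for h r
    using vertex_on_edge[of h r] attachingD[OF h(1)] h assms by auto
  then show ?thesis unfolding grow_def by blast
qed

lemma tip_notin_grow:
  assumes "v \<notin> B" "t \<in> {0..<1}"
  shows "v \<notin> grow v t"
proof -
  have False if h: "h \<in> attaching v" "r \<in> {0..t}" "v = h r" for h r
    using edge_eq_iff[of h 1 r] attachingD[OF h(1)] h assms by auto
  then show ?thesis using assms unfolding grow_def by blast
qed

lemma tip_in_grow:
  assumes "attaching v \<noteq> {}"
  shows "v \<in> grow v 1"
proof -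
  obtain h where h: "h \<in> attaching v" using assms by blast
  have "h 1 \<in> h ` {0..1}" by simp
  then show ?thesis using h attachingD(3)[OF h] unfolding grow_def by blast
qed

lemma hausdorff_continuous_on_grow: "hausdorff_continuous_on {0..1} (grow v)"
  unfolding hausdorff_continuous_on_def
proof (intro ballI allI impI)
  fix t \<epsilon> :: real assume t: "t \<in> {0..1}" and \<epsilon>: "\<epsilon> > 0"
  have "\<exists>d>0. \<forall>x\<in>{0..1}. \<forall>y\<in>{0..1}. dist y x < d \<longrightarrow> dist (h y) (h x) < \<epsilon>/2" if "h \<in> attaching v" for h
    using compact_uniformly_continuous[OF continuous_on_edge[OF attachingD(1)[OF that]]] \<epsilon>
    unfolding uniformly_continuous_on_def by (meson compact_Icc half_gt_zero)
  then obtain d where d: "\<And>h. h \<in> attaching v \<Longrightarrow> d h > 0"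
    "\<And>h x y. h \<in> attaching v \<Longrightarrow> x \<in> {0..1} \<Longrightarrow> y \<in> {0..1} \<Longrightarrow> dist y x < d h \<Longrightarrow> dist (h y) (h x) < \<epsilon>/2"
    by metis
  \<comment> \<open>The 1 keeps the minimum defined when no edge attaches.\<close>
  define \<delta> where "\<delta> = Min (insert 1 (d ` attaching v))"
  have \<delta>: "\<delta> > 0" "\<And>h. h \<in> attaching v \<Longrightarrow> \<delta> \<le> d h"
    using d finite_attaching by (auto simp: \<delta>_def)
  \<comment> \<open>A point \<open>h r\<close> of the larger set is matched with
    \<open>h (min r u)\<close>: itself if it is still there, otherwise the tip of the shorter
    segment. The bound is half of \<open>\<epsilon>\<close> because suprema preserve only weak
    inequalities.\<close>
  have near: "\<exists>y\<in>grow v u. dist x y \<le> \<epsilon>/2"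
    if u: "u \<in> {0..1}" "s \<in> {0..1}" "\<bar>s - u\<bar> < \<delta>" and x: "x \<in> grow v s" for s u x
  proof (cases "x \<in> B")
    case True
    then show ?thesis using \<epsilon> by (intro bexI[of _ x]) (auto simp: grow_def)
  next
    case False
    then obtain h r where h: "h \<in> attaching v" "0 \<le> r" "r \<le> s" "x = h r" using x by (auto simp: grow_def)
    have "dist r (min r u) < d h" using h u \<delta>(2)[OF h(1)] by (auto simp: dist_real_def min_def)
    then have "dist (h r) (h (min r u)) < \<epsilon>/2" using h u by (intro d(2)) auto
    moreover have "h (min r u) \<in> grow v u" using h u unfolding grow_def by (intro UnI2 UN_I[of h]) auto
    ultimately show ?thesis using h by (intro bexI[of _ "h (min r u)"]) auto
  qed
  have "hausdorff_dist (grow v s) (grow v t) \<le> \<epsilon>/2" if "s \<in> {0..1}" "\<bar>s - t\<bar> < \<delta>" for s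
    using that t near by (intro hausdorff_dist_le) (auto simp: abs_minus_commute grow_def intro: a)
  then show "\<exists>d>0. \<forall>s\<in>{0..1}. \<bar>s - t\<bar> < d \<longrightarrow> hausdorff_dist (grow v s) (grow v t) < \<epsilon>"
    using \<delta>(1) \<epsilon> by (intro exI[of _ \<delta>]) (force simp del: atLeastAtMost_iff)
qed

lemma openin_complement_grow:
  assumes "t \<in> {0..1}"
  shows "openin (top_of_set G) (G - grow v t)"
proof -
  have "closed (grow v t)" using grow_subcontinuum[OF assms] by (simp add: subcontinua_def)
  then show ?thesis by (simp add: Diff_eq openin_open_Int open_Compl)
qed

lemma openin_complement_B: "openin (top_of_set G) (G - B)"
  using openin_complement_grow[of 0] grow_0 by simp

section \<open>The complement before the vertex is reached\<close>

text \<open>A separation of the complement would extend to one of \<open>G - B\<close>. The unfilled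
  ends of the attaching edges all run to \<open>v\<close> and hence lie on the side of
  \<open>v\<close>, and the filled parts outside \<open>B\<close> can be added to that side.\<close>

lemma connected_complement_grow:
  assumes v: "v \<in> V - B" and t: "t \<in> {0..<1}"
  shows "connected (G - grow v t)"
proof (rule ccontr)
  let ?W = "G - grow v t"
  assume "\<not> connected ?W"
  then obtain W1 W2 where W: "openin (top_of_set ?W) W1" "openin (top_of_set ?W) W2"
      "W1 \<union> W2 = ?W" "W1 \<inter> W2 = {}" "W1 \<noteq> {}" "W2 \<noteq> {}"
    unfolding connected_openin_eq by blast
  have no: False if X: "openin (top_of_set ?W) X1" "openin (top_of_set ?W) X2"
      "X1 \<union> X2 = ?W" "X1 \<inter> X2 = {}" "X2 \<noteq> {}" "v \<in> X1" for X1 X2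
  proof -
    have oW: "openin (top_of_set G) ?W" using t by (intro openin_complement_grow) auto
    have tail: "h ` {0..1} \<inter> ?W \<subseteq> X1" if h: "h \<in> attaching v" for h
    proof
      note hE = attachingD[OF h]
      fix x assume "x \<in> h ` {0..1} \<inter> ?W"
      then obtain r where r: "r \<in> {0..1}" "x = h r" "x \<notin> grow v t" by blast
      \<comment> \<open>The end of the edge does not return to \<open>B\<close> by
        \<open>leave_B\<close>. It is not on a filled segment either: the only edges whose interior
        meets that of \<open>h\<close> are \<open>h\<close> and its reversal, and the reversal
        starts at \<open>v\<close>, outside \<open>B\<close>.\<close>
      have sub: "h ` {r..1} \<subseteq> ?W"
      proof
        fix y assume "y \<in> h ` {r..1}"
        then obtain q where q: "q \<in> {r..1}" "y = h q" by blast
        have "h r \<notin> B" using r by (auto simp: grow_def)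
        then have "y \<notin> B" using leave_B[OF hE(1,2) r(1)] q by blast
        have rt: "r > t" using r h unfolding grow_def by (meson UN_I UnI2 atLeastAtMost_iff image_eqI not_le)
        have False if k: "k \<in> attaching v" "w \<in> {0..t}" "y = k w" for k w
        proof (cases "w = 0")
          case True
          then show False using k attachingD(2) \<open>y \<notin> B\<close> by blast
        next
          case False
          then have w: "w \<in> {0<..<1}" using k t by auto
          have "y \<noteq> v" using tip_notin_grow[OF _ t, of v] v k unfolding grow_def by blast
          then have "q \<noteq> 1" using q hE by auto
          then have "q \<in> {0<..<1}" using q rt t by auto
          then have "k = h \<or> k = reversepath h"
            using edges_disjoint[OF hE(1) attachingD(1)[OF k(1)]] w q k by blast
          moreover have "k \<noteq> reversepath h"
            using attachingD[OF k(1)] hE v by (auto simp: reversepath_def)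
          ultimately have "h q = h w" using q k by simp
          then have "q = w" using edge_eq_iff[OF hE(1), of q w] q r w by auto
          then show False using q rt k by auto
        qed
        then have "y \<notin> grow v t" using \<open>y \<notin> B\<close> unfolding grow_def by blast
        moreover have "y \<in> G" using q r edge_in_graph[OF hE(1)] by auto
        ultimately show "y \<in> ?W" by blast
      qed
      have con: "connected (h ` {r..1})"
        using r by (intro connected_edge_segment[OF hE(1)]) (auto simp: is_interval_cc)
      have "v \<in> h ` {r..1}" using r hE by force
      then have meets: "h ` {r..1} \<inter> X1 \<noteq> {}" using X by blast
      have clo: "closedin (top_of_set ?W) X1"
      proof -
        have "X1 = ?W - X2" using X by blast
        then show ?thesis using X(2) by (metis closedin_diff closedin_topspace topspace_euclidean_subtopology)
      qed
      have "h ` {r..1} \<subseteq> X1"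
        by (rule connected_subset_clopen[OF con sub meets X(1) clo])
      moreover have "x \<in> h ` {r..1}" using r by auto
      ultimately show "x \<in> X1" by blast
    qed
    \<comment> \<open>Whole open edges are added, not just their filled parts, so that
      \<open>Y\<close> is a union of open sets. The unfilled parts belong to \<open>X1\<close>
      already by \<open>tail\<close>.\<close>
    define Y where "Y = X1 \<union> (\<Union>h\<in>attaching v. h ` {0<..<1} \<inter> (G - B))"
    have "openin (top_of_set G) Y" unfolding Y_def
      using X(1) oW openin_complement_B
      by (intro openin_Un openin_Union openin_Int) (auto intro!: openin_Int openin_edge_segment intro: openin_trans dest: attachingD)
    moreover have "openin (top_of_set G) X2" using X(2) oW openin_trans by blast
    moreover have "h r \<notin> X2" if h: "h \<in> attaching v" "r \<in> {0<..<1}" for h r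
    proof
      assume "h r \<in> X2"
      then have "h r \<in> h ` {0..1} \<inter> ?W" using X h by auto
      then show False using tail[OF h(1)] X \<open>h r \<in> X2\<close> by blast
    qed
    then have "Y \<inter> X2 = {}" using X(4) unfolding Y_def by blast
    moreover have "Y \<union> X2 = G - B"
    proof
      show "Y \<union> X2 \<subseteq> G - B" using X(3) unfolding Y_def grow_def by blast
      show "G - B \<subseteq> Y \<union> X2"
      proof
        fix x assume x: "x \<in> G - B"
        show "x \<in> Y \<union> X2"
        proof (cases "x \<in> grow v t")
          case True
          then obtain h r where h: "h \<in> attaching v" "r \<in> {0..t}" "x = h r" using x by (auto simp: grow_def)
          then have "r \<noteq> 0" using attachingD x by auto
          then have "r \<in> {0<..<1}" using h t by auto
          then show ?thesis using h x unfolding Y_def by blast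
        next
          case False
          then show ?thesis using X(3) x unfolding Y_def by blast
        qed
      qed
    qed
    moreover have "Y \<noteq> {}" using X by (auto simp: Y_def)
    moreover have "openin (top_of_set (G - B)) T" if "openin (top_of_set G) T" "T \<subseteq> G - B" for T
      using openin_subset_trans[OF that] by blast
    moreover have "Y \<subseteq> G - B" "X2 \<subseteq> G - B" using \<open>Y \<union> X2 = G - B\<close> by blast+
    ultimately have "openin (top_of_set (G - B)) Y" "openin (top_of_set (G - B)) X2" by blast+
    then show False
      using B_facts(4) \<open>Y \<union> X2 = G - B\<close> \<open>Y \<inter> X2 = {}\<close> \<open>Y \<noteq> {}\<close> X(5)
      unfolding connected_openin_eq by blast
  qed
  have "v \<in> ?W" using tip_notin_grow t v V_subset by auto
  then have "v \<in> W1 \<or> v \<in> W2" using W by blast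
  then show False using no[of W1 W2] no[of W2 W1] W by blast
qed

section \<open>Choosing the next vertex\<close>

text \<open>The part of the edge around \<open>x\<close> that avoids \<open>B\<close> and
  \<open>v\<close> is connected, so \<open>X\<close> swallows it together with an end of the edge.
  Excluding attaching edges ensures that such an end exists. This turns clopen pieces into
  combinatorial objects: they contain vertices and are made up of edges.\<close>

lemma clopen_edge:
  assumes v: "v \<in> V"
    and X: "openin (top_of_set (G - B - {v})) X" "closedin (top_of_set (G - B - {v})) X"
    and x: "x \<in> X" "x \<notin> V" "x \<notin> (\<Union>h\<in>attaching v. path_image h)"
  obtains e where "e \<in> E" "x \<in> path_image e" "e 1 \<in> X" "e 0 \<in> B \<or> path_image e - {v} \<subseteq> X"
proof -
  note result = that
  have XU: "X \<subseteq> G - B - {v}" using X(1) openin_imp_subset by blast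
  have absorb: "C \<subseteq> X" if "connected C" "C \<subseteq> G - B - {v}" "x \<in> C" for C
    using connected_subset_clopen[OF that(1,2) _ X] that(3) x(1) by blast
  have onv: "q = 0 \<or> q = 1" if "e \<in> E" "q \<in> {0..1}" "e q = v" for e q
    using vertex_on_edge that v by blast
  have mixed: thesis if e: "e \<in> E" "e 0 \<in> B" "e 1 \<notin> B" "t \<in> {0<..<1}" "x = e t" for e t
  proof -
    have xe: "x \<in> path_image e" using e by (auto simp: path_image_def)
    then have e1: "e 1 \<noteq> v" using x(3) e by (auto simp: attaching_def)
    have "e ` {t..1} \<subseteq> X"
    proof (rule absorb)
      show "connected (e ` {t..1})"
        using e by (intro connected_edge_segment) (auto simp: is_interval_cc)
      show "x \<in> e ` {t..1}" using e by auto
      have "e q \<in> G - B - {v}" if "q \<in> {t..1}" for q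
      proof -
        have q: "q \<in> {0..1}" "q \<noteq> 0" "t \<in> {0..1}" using that e by auto
        have "e q \<notin> B" using leave_B[OF e(1,2) q(3) _ that] x XU e by blast
        moreover have "e q \<noteq> v" using onv[OF e(1) q(1)] q e1 by auto
        ultimately show ?thesis using edge_in_graph[OF e(1) q(1)] by blast
      qed
      then show "e ` {t..1} \<subseteq> G - B - {v}" by blast
    qed
    moreover have "e 1 \<in> e ` {t..1}" using e by auto
    ultimately show thesis using result[of e] e xe by blast
  qed
  have outside: thesis
    if e: "e \<in> E" "e 0 \<notin> B" "e 1 \<notin> B" "e 1 \<noteq> v" "t \<in> {0<..<1}" "x = e t" for e t
  proof -
    have U: "e q \<in> G - B" if "q \<in> {0..1}" for q
      using edge_in_graph[OF e(1) that] edge_outside_B[OF e(1-3) that] by blast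
    \<comment> \<open>The interval is open at 0 because \<open>e 0\<close> may be
      \<open>v\<close>.\<close>
    have half: "e ` {0<..1} \<subseteq> X"
    proof (rule absorb)
      show "connected (e ` {0<..1})"
        using e by (intro connected_edge_segment) (auto simp: is_interval_oc)
      show "x \<in> e ` {0<..1}" using e by auto
      have "e q \<in> G - B - {v}" if "q \<in> {0<..1}" for q
        using U[of q] onv[OF e(1), of q] that e(4) by auto
      then show "e ` {0<..1} \<subseteq> G - B - {v}" by blast
    qed
    have "path_image e - {v} \<subseteq> X"
    proof (cases "e 0 = v")
      case True
      have "{0..1} = insert 0 {0<..(1::real)}" by auto
      then have "path_image e = insert v (e ` {0<..1})" using True by (simp add: path_image_def)
      then show ?thesis using half by blast
    next
      case False
      have "e ` {0..1} \<subseteq> X"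
      proof (rule absorb)
        show "connected (e ` {0..1})"
          using e by (intro connected_edge_segment) (auto simp: is_interval_cc)
        show "x \<in> e ` {0..1}" using e by auto
        have "e q \<in> G - B - {v}" if "q \<in> {0..1}" for q
          using U[of q] onv[OF e(1), of q] that e(4) False by auto
        then show "e ` {0..1} \<subseteq> G - B - {v}" by blast
      qed
      then show ?thesis by (auto simp: path_image_def)
    qed
    moreover have "e 1 \<in> X" using half by auto
    moreover have "x \<in> path_image e" using e by (auto simp: path_image_def)
    ultimately show thesis using result[of e] e by blast
  qed
  have "x \<in> G - B" using x XU by blast
  then obtain e t where e: "e \<in> E" "t \<in> {0..1}" "x = e t"
    using edges_cover unfolding path_image_def by blast
  have "t \<noteq> 0" "t \<noteq> 1" using e x edge_start edge_end by auto
  then have t: "t \<in> {0<..<1}" "1 - t \<in> {0<..<1}" using e by auto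
  let ?r = "reversepath e"
  have r: "?r \<in> E" "?r 0 = e 1" "?r 1 = e 0" "x = ?r (1 - t)"
    using e reversepath_edge by (auto simp: reversepath_def)
  have ne: "e 0 \<noteq> e 1" using edge_eq_iff[OF e(1), of 0 1] by simp
  have "\<not> (e 0 \<in> B \<and> e 1 \<in> B)"
    using leave_B[OF e(1) _ e(2), of 1] e \<open>x \<in> G - B\<close> by auto
  \<comment> \<open>The last two cases may overlap: the ends are distinct, so at least one differs
    from \<open>v\<close>, and reversing the edge if necessary makes it \<open>e 1\<close>.\<close>
  then consider "e 0 \<in> B" "e 1 \<notin> B" | "e 0 \<notin> B" "e 1 \<in> B" | "e 0 \<notin> B" "e 1 \<notin> B" "e 1 \<noteq> v"
    | "e 0 \<notin> B" "e 1 \<notin> B" "e 0 \<noteq> v"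
    using ne by auto
  then show thesis
  proof cases
    case 1
    then show thesis using mixed[OF e(1) _ _ t(1) e(3)] by blast
  next
    case 2
    then show thesis using mixed[OF r(1) _ _ t(2) r(4)] r by simp
  next
    case 3
    then show thesis using outside[OF e(1) _ _ _ t(1) e(3)] by blast
  next
    case 4
    then show thesis using outside[OF r(1) _ _ _ t(2) r(4)] r by simp
  qed
qed

text \<open>Otherwise the piece X, stripped of the edges that run from B to v, would be cut off from the
  rest of the graph by v.\<close>

lemma clopen_piece_adjacent:
  assumes v: "v \<in> V - B"
    and X: "openin (top_of_set (G - B - {v})) X" "closedin (top_of_set (G - B - {v})) X"
    and XV: "X \<inter> V \<noteq> {}"
  shows "\<exists>e\<in>E. e 0 \<in> B \<and> e 1 \<in> X"
proof (rule ccontr)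
  assume neg: "\<not> ?thesis"
  have XU: "X \<subseteq> G - B - {v}" using X(1) openin_imp_subset by blast
  define A where "A = (\<Union>h\<in>attaching v. path_image h)"
  \<comment> \<open>\<open>X\<close> is closed only relative to \<open>G - B - {v}\<close> and may
    accumulate at \<open>B\<close>. Attaching edges do so, hence their removal. What is left is
    covered, up to \<open>v\<close>, by vertices and by the finitely many closed edges in
    \<open>F\<close>, which shows it to be closed in all of \<open>G - {v}\<close>.\<close>
  define Y where "Y = X - A"
  define F where "F = {e \<in> E. path_image e - {v} \<subseteq> Y}"
  have AV: "y = v \<or> y \<in> B" if y: "y \<in> A" "y \<in> V" for y
  proof -
    obtain h q where h: "h \<in> attaching v" "q \<in> {0..1}" "y = h q"
      using y unfolding A_def path_image_def by blast
    then show ?thesis using vertex_on_edge[of h q] attachingD[OF h(1)] y by auto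
  qed
  have XVY: "X \<inter> V \<subseteq> Y" using AV XU unfolding Y_def by blast
  have inF: "\<exists>e\<in>F. y \<in> path_image e" if y: "y \<in> Y" "y \<notin> V" for y
  proof -
    obtain e where e: "e \<in> E" "y \<in> path_image e" "e 1 \<in> X" "e 0 \<in> B \<or> path_image e - {v} \<subseteq> X"
      using clopen_edge[OF _ X, of y] v y unfolding Y_def A_def by blast
    then have sub: "path_image e - {v} \<subseteq> X" using neg by blast
    have "e 0 \<in> path_image e" by (auto simp: path_image_def)
    then have e0: "e 0 \<notin> B" using sub XU v by blast
    have "z \<notin> A" if z: "z \<in> path_image e - {v}" for z
    proof
      assume "z \<in> A"
      then have zV: "z \<notin> V" using AV z sub XU by blast
      obtain h q where h: "h \<in> attaching v" "q \<in> {0..1}" "z = h q"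
        using \<open>z \<in> A\<close> unfolding A_def path_image_def by blast
      obtain s where s: "s \<in> {0..1}" "z = e s" using z by (auto simp: path_image_def)
      note hE = attachingD[OF h(1)]
      have "q \<noteq> 0" "q \<noteq> 1" "s \<noteq> 0" "s \<noteq> 1"
        using zV h s edge_start[OF e(1)] edge_end[OF e(1)] edge_start[OF hE(1)] edge_end[OF hE(1)] by metis+
      then have "q \<in> {0<..<1}" "s \<in> {0<..<1}" using h s by auto
      then have "e ` {0<..<1} \<inter> h ` {0<..<1} \<noteq> {}" using h s by blast
      then have "h = e \<or> h = reversepath e" using edges_disjoint[OF e(1) hE(1)] by blast
      then have "h 0 = e 0 \<or> h 0 = e 1" by (auto simp: reversepath_def)
      then show False using hE e0 e(3) XU by auto
    qed
    then have "e \<in> F" using sub e unfolding F_def Y_def by blast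
    then show ?thesis using e by blast
  qed
  have Y_eq: "Y = (G - {v}) \<inter> ((X \<inter> V) \<union> (\<Union>e\<in>F. path_image e))"
  proof
    show "Y \<subseteq> (G - {v}) \<inter> ((X \<inter> V) \<union> (\<Union>e\<in>F. path_image e))"
      using inF XU unfolding Y_def by blast
    show "(G - {v}) \<inter> ((X \<inter> V) \<union> (\<Union>e\<in>F. path_image e)) \<subseteq> Y"
      using XVY unfolding F_def by blast
  qed
  have "closed ((X \<inter> V) \<union> (\<Union>e\<in>F. path_image e))"
    using finite_V finite_E unfolding F_def
    by (intro closed_Un closed_UN ballI finite_imp_closed compact_imp_closed[OF compact_path_image_edge]) auto
  then have clo: "closedin (top_of_set (G - {v})) Y"
    unfolding Y_eq by (rule closedin_closed_Int)
  have "closed A"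
    unfolding A_def using finite_attaching
    by (intro closed_UN ballI compact_imp_closed[OF compact_path_image_edge]) (auto dest: attachingD)
  obtain S where S: "open S" "X = (G - B - {v}) \<inter> S" using X(1) by (auto simp: openin_open)
  have "Y = (G - {v}) \<inter> (S - B - A)" unfolding Y_def S by blast
  moreover have "open (S - B - A)" using S B_facts(1) \<open>closed A\<close> by (intro open_Diff)
  ultimately have ope: "openin (top_of_set (G - {v})) Y" by (auto simp: openin_open)
  have "connected (G - {v})" using no_cut_points v V_subset by blast
  then have "Y = {} \<or> Y = G - {v}" using ope clo unfolding connected_clopen by blast
  moreover have "a \<in> G - {v}" "a \<notin> Y" using a v B_facts XU unfolding Y_def by auto
  ultimately show False using XV XVY by blast
qed

text \<open>The vertex to absorb next is the one whose removal from the complement of B leaves the most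
  vertices connected to p: a further piece cut off from p would contain a better candidate.\<close>

lemma exists_next_vertex:
  assumes "V - B \<noteq> {p}"
  obtains v where "v \<in> V - B" "v \<noteq> p" "attaching v \<noteq> {}" "connected (G - grow v 1)"
proof -
  define N where "N = {v \<in> V - B - {p}. attaching v \<noteq> {}}"
  define f where "f = (\<lambda>v. card (V \<inter> connected_component_set (G - B - {v}) p))"
  have adj: "\<exists>w\<in>N. w \<in> X" if X: "v \<in> V - B" "p \<notin> X" "openin (top_of_set (G - B - {v})) X"
      "closedin (top_of_set (G - B - {v})) X" "X \<inter> V \<noteq> {}" for v X
  proof -
    obtain e where e: "e \<in> E" "e 0 \<in> B" "e 1 \<in> X"
      using clopen_piece_adjacent[OF X(1,3-5)] by blast
    then have "e \<in> attaching (e 1)" by (auto simp: attaching_def)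
    moreover have "X \<subseteq> G - B" using openin_imp_subset[OF X(3)] by blast
    ultimately show ?thesis using e edge_end X(2) unfolding N_def by blast
  qed
  have "p \<in> V - B" "(G - B - {p}) \<inter> V \<noteq> {}" using p assms V_subset by auto
  \<comment> \<open>Here \<open>p\<close> itself plays the role of the removed vertex, and the piece
    is everything else outside \<open>B\<close>.\<close>
  then have "N \<noteq> {}" using adj[of p "G - B - {p}"] by auto
  moreover have finN: "finite N" using finite_V by (auto simp: N_def)
  ultimately have "Max (f ` N) \<in> f ` N" by (intro Max_in) auto
  then obtain v where v: "v \<in> N" "f v = Max (f ` N)" by auto
  have fmax: "f w \<le> f v" if "w \<in> N" for w using v(2) finN that by simp
  have vV: "v \<in> V - B" "v \<noteq> p" "attaching v \<noteq> {}" using v(1) by (auto simp: N_def)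
  let ?W = "G - grow v 1" and ?U = "G - B - {v}"
  have "v \<in> grow v 1" using tip_in_grow vV by blast
  have oW: "openin (top_of_set G) ?W" by (rule openin_complement_grow) auto
  have "connected ?W"
  proof (rule ccontr)
    assume "\<not> connected ?W"
    then obtain W1 W2 where W: "openin (top_of_set ?W) W1" "openin (top_of_set ?W) W2"
        "W1 \<union> W2 = ?W" "W1 \<inter> W2 = {}" "W1 \<noteq> {}" "W2 \<noteq> {}"
      unfolding connected_openin_eq by blast
    have no: False if X: "openin (top_of_set ?W) X1" "openin (top_of_set ?W) X2"
        "X1 \<union> X2 = ?W" "X1 \<inter> X2 = {}" "X2 \<noteq> {}" "p \<in> X1" for X1 X2
    proof -
      have WU: "?W \<subseteq> ?U" using \<open>v \<in> grow v 1\<close> by (auto simp: grow_def)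
      have X1: "openin (top_of_set G) X1" and X2: "openin (top_of_set G) X2"
        using X oW openin_trans by blast+
      have sub: "openin (top_of_set ?U) T" if "openin (top_of_set G) T" "T \<subseteq> ?U" for T
        using openin_subset_trans[OF that] by blast
      \<comment> \<open>\<open>R\<close> is the side of \<open>p\<close> after the open attaching
        edges have been put back, so that \<open>R\<close> and \<open>X2\<close> split
        \<open>?U\<close>, where only \<open>v\<close> and \<open>B\<close> are missing.\<close>
      define R where "R = X1 \<union> (\<Union>h\<in>attaching v. h ` {0<..<1} \<inter> (G - B))"
      have int: "h ` {0<..<1} \<subseteq> grow v 1 - {v}" if "h \<in> attaching v" for h
      proof -
        have "h ` {0<..<1} \<subseteq> h ` {0..1}" by (intro image_mono) auto
        moreover have "v \<notin> h ` {0<..<1}" using edge_interior[OF attachingD(1)[OF that]] vV by blast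
        ultimately show ?thesis using that unfolding grow_def by blast
      qed
      have R: "R = ?U - X2"
      proof
        have "X1 \<subseteq> ?U - X2" using X(3,4) WU by blast
        moreover have "h ` {0<..<1} \<inter> (G - B) \<subseteq> ?U - X2" if "h \<in> attaching v" for h
          using int[OF that] X(3) by blast
        ultimately show "R \<subseteq> ?U - X2" unfolding R_def by (intro Un_least UN_least)
        show "?U - X2 \<subseteq> R"
        proof
          fix x assume x: "x \<in> ?U - X2"
          show "x \<in> R"
          proof (cases "x \<in> grow v 1")
            case True
            then obtain h q where h: "h \<in> attaching v" "q \<in> {0..1}" "x = h q"
              using x unfolding grow_def by blast
            then have "q \<noteq> 0" "q \<noteq> 1" using x attachingD[OF h(1)] by auto
            then have "q \<in> {0<..<1}" using h by auto
            then show ?thesis using h x unfolding R_def by blast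
          next
            case False
            then show ?thesis using x X(3) unfolding R_def by blast
          qed
        qed
      qed
      have "openin (top_of_set G) R" unfolding R_def
        using X1 openin_complement_B
        by (intro openin_Un openin_Union) (auto intro!: openin_Int openin_edge_segment dest: attachingD)
      then have oR: "openin (top_of_set ?U) R" using sub R by blast
      have oX2: "openin (top_of_set ?U) X2" using sub[OF X2] X(3) WU by blast
      have "X2 \<subseteq> ?U" using X(3) WU by blast
      then have "X2 = ?U - R" using R by blast
      then have cX2: "closedin (top_of_set ?U) X2"
        using oR by (metis closedin_diff closedin_topspace topspace_euclidean_subtopology)
      have cR: "closedin (top_of_set ?U) R"
        using oX2 R by (metis closedin_diff closedin_topspace topspace_euclidean_subtopology)
      have "X2 \<inter> V \<noteq> {}"
      proof -
        obtain x where x: "x \<in> X2" using X by blast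
        show ?thesis
        proof (cases "x \<in> V")
          case True
          then show ?thesis using x by blast
        next
          case False
          have "x \<notin> (\<Union>h\<in>attaching v. path_image h)"
            using x X(3) unfolding grow_def path_image_def by blast
          then obtain e where "e \<in> E" "e 1 \<in> X2"
            using clopen_edge[OF _ oX2 cX2 x False] vV by blast
          then show ?thesis using edge_end by blast
        qed
      qed
      then obtain w where w: "w \<in> N" "w \<in> X2"
        using adj[OF vV(1) _ oX2 cX2] X by blast
      \<comment> \<open>Removing \<open>v\<close> from the connected set \<open>G - B\<close> leaves
        \<open>R\<close> as a clopen piece; such a piece together with \<open>v\<close> is
        connected.\<close>
      have "connected ({v} \<union> R)"
        using vV V_subset cR oR B_facts(4)
        by (intro connected_Un_clopen_in_complement[of "{v}" "G - B"]) auto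
      moreover have "{v} \<union> R \<subseteq> G - B - {w}" using R w vV V_subset \<open>X2 \<subseteq> ?U\<close> by blast
      moreover have "p \<in> R" using X unfolding R_def by blast
      ultimately have big: "{v} \<union> R \<subseteq> connected_component_set (G - B - {w}) p"
        by (intro connected_component_maximal) auto
      let ?C = "connected_component_set ?U p"
      have "?C \<inter> X2 = {}"
      proof (rule ccontr)
        assume "?C \<inter> X2 \<noteq> {}"
        then have "?C \<subseteq> X2"
          by (intro connected_subset_clopen[OF connected_connected_component connected_component_subset _ oX2 cX2])
        moreover have "p \<in> ?C" using p V_subset vV by (auto intro: connected_component_refl)
        ultimately show False using X by blast
      qed
      then have "?C \<subseteq> R" using R connected_component_subset[of ?U p] by blast
      moreover have "v \<notin> ?C" using connected_component_subset[of ?U p] by blast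
      \<comment> \<open>Removing \<open>w\<close> in place of \<open>v\<close> keeps all of
        \<open>R\<close> attached to \<open>p\<close> and gains the vertex \<open>v\<close>, against
        the maximality of \<open>f v\<close>.\<close>
      ultimately have "V \<inter> ?C \<subset> V \<inter> connected_component_set (G - B - {w}) p"
        using big vV by blast
      then have "f v < f w" unfolding f_def using finite_V by (intro psubset_card_mono) auto
      then show False using fmax[OF w(1)] by simp
    qed
    have "p \<notin> grow v 1" using vertex_in_grow[of p v 1] p vV by auto
    then have "p \<in> W1 \<or> p \<in> W2" using W p V_subset by blast
    then show False using no[of W1 W2] no[of W2 W1] W by blast
  qed
  then show thesis using that vV by blast
qed

section \<open>The last step and the assembly of the path\<close>

text \<open>With \<open>p\<close> the only vertex left, an edge either has both ends in
  \<open>B\<close> and lies in \<open>B\<close>, or joins \<open>B\<close> to \<open>p\<close> and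
  attaches to \<open>p\<close> in one of its orientations.\<close>

lemma grow_last:
  assumes "V - B = {p}"
  shows "grow p 1 = G"
proof
  show "grow p 1 \<subseteq> G" using grow_subcontinuum[of 1] by (simp add: subcontinua_def)
  show "G \<subseteq> grow p 1"
  proof
    fix x assume "x \<in> G"
    then obtain e where e: "e \<in> E" "x \<in> path_image e" using edges_cover by blast
    then obtain t where t: "t \<in> {0..1}" "x = e t" by (auto simp: path_image_def)
    have ends: "e 0 = p \<or> e 0 \<in> B" "e 1 = p \<or> e 1 \<in> B" "e 0 \<noteq> e 1"
      using assms edge_start[OF e(1)] edge_end[OF e(1)] edge_eq_iff[OF e(1), of 0 1] by auto
    consider "e 0 \<in> B" "e 1 \<in> B" | "e \<in> attaching p" | "reversepath e \<in> attaching p"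
      using ends e reversepath_edge by (auto simp: attaching_def reversepath_def)
    then show "x \<in> grow p 1"
    proof cases
      case 1
      then have "x \<in> B" using leave_B[OF e(1) _ t(1), of 1] t by auto
      then show ?thesis by (simp add: grow_def)
    next
      case 2
      then show ?thesis using e unfolding grow_def path_image_def by blast
    next
      case 3
      then have "x \<in> path_image (reversepath e)" using e by simp
      then show ?thesis using 3 unfolding grow_def path_image_def by blast
    qed
  qed
qed

end

lemma (in partial_growth) growth_path:
  "\<exists>\<alpha>. hausdorff_continuous_on {0..1} \<alpha> \<and> (\<forall>t\<in>{0..1}. \<alpha> t \<in> NCstar G) \<and>
     \<alpha> 0 = B \<and> \<alpha> 1 = G \<and> (\<forall>t\<in>{0..1}. \<alpha> t = G \<or> p \<notin> \<alpha> t)"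
  \<comment> \<open>The locale predicate becomes a premise of the induction, so that
    \<open>B\<close> can be replaced by the grown set while \<open>V\<close>, \<open>E\<close>,
    \<open>p\<close> and \<open>a\<close> are kept.\<close>
  using partial_growth_axioms
proof (induction "card (V - B)" arbitrary: B rule: less_induct)
  case less
  interpret S: partial_growth G V E B p a by (rule less.prems)
  have NC: "S.grow v t \<in> NCstar G" if "v \<in> V - B" "t \<in> {0..<1}" for v t
    using S.grow_subcontinuum[of t v] S.connected_complement_grow[OF that] that
    by (simp add: NCstar_def)
  show ?case
  proof (cases "V - B = {p}")
    case True
    have last: "S.grow p 1 = G" using S.grow_last True by blast
    then have G: "G \<in> NCstar G"
      using S.grow_subcontinuum[of 1 p] by (simp add: NCstar_def)
    have "S.grow p t \<in> NCstar G \<and> (S.grow p t = G \<or> p \<notin> S.grow p t)" if t: "t \<in> {0..1}" for t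
    proof (cases "t = 1")
      case True
      then show ?thesis using last G by simp
    next
      case False
      then have "t \<in> {0..<1}" using t by auto
      then show ?thesis using NC[of p t] S.tip_notin_grow[of p t] S.p by blast
    qed
    then show ?thesis
      using last S.grow_0 S.hausdorff_continuous_on_grow by (intro exI[of _ "S.grow p"]) blast
  next
    case False
    then obtain v where v: "v \<in> V - B" "v \<noteq> p" "S.attaching v \<noteq> {}" "connected (G - S.grow v 1)"
      using S.exists_next_vertex by blast
    have NC': "S.grow v t \<in> NCstar G" if "t \<in> {0..1}" for t
    proof (cases "t = 1")
      case True
      then show ?thesis using v(4) S.grow_subcontinuum[of 1 v] by (simp add: NCstar_def)
    next
      case False
      then show ?thesis using NC[OF v(1)] that by simp
    qed
    have p: "p \<notin> S.grow v t" if "t \<in> {0..1}" for t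
      using S.vertex_in_grow[OF S.p(1) not_sym[OF v(2)] that] S.p by blast
    have "B \<subseteq> S.grow v 1" by (auto simp: S.grow_def)
    have "partial_growth G V E (S.grow v 1) p a"
      using NC'[of 1] p[of 1] S.p S.a \<open>B \<subseteq> S.grow v 1\<close> S.no_cut_points by unfold_locales auto
    moreover have "V - S.grow v 1 \<subset> V - B" using v S.tip_in_grow[OF v(3)] \<open>B \<subseteq> S.grow v 1\<close> by blast
    then have "card (V - S.grow v 1) < card (V - B)" using finite_V by (intro psubset_card_mono) auto
    ultimately obtain \<beta> where \<beta>: "hausdorff_continuous_on {0..1} \<beta>" "\<forall>t\<in>{0..1}. \<beta> t \<in> NCstar G"
        "\<beta> 0 = S.grow v 1" "\<beta> 1 = G" "\<forall>t\<in>{0..1}. \<beta> t = G \<or> p \<notin> \<beta> t"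
      using less.hyps by blast
    let ?\<gamma> = "\<lambda>t. if t \<le> 1/2 then S.grow v (2 * t) else \<beta> (2 * t - 1)"
    have "hausdorff_continuous_on {0..1} ?\<gamma>"
      using S.hausdorff_continuous_on_grow \<beta>(1,3) by (intro hausdorff_continuous_on_join) auto
    moreover have "?\<gamma> t \<in> NCstar G \<and> (?\<gamma> t = G \<or> p \<notin> ?\<gamma> t)" if "t \<in> {0..1}" for t
    proof (cases "t \<le> 1/2")
      case True
      then show ?thesis using NC'[of "2 * t"] p[of "2 * t"] that by simp
    next
      case False
      then have "2 * t - 1 \<in> {0..1}" using that by auto
      then show ?thesis using \<beta>(2,5) False by (simp del: atLeastAtMost_iff)
    qed
    moreover have "?\<gamma> 0 = B" "?\<gamma> 1 = G" using S.grow_0 \<beta>(4) by simp_all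
    ultimately show ?thesis by (intro exI[of _ ?\<gamma>]) blast
  qed
qed

theorem theorem4:
  fixes G :: "'a::metric_space set" and p :: 'a and A :: "'a set"
  assumes "tangle G" and "p \<in> G" and "A \<in> NCstar G" and "p \<notin> A"
  shows "\<exists>\<alpha>::real \<Rightarrow> 'a set.
           hausdorff_continuous_on {0..1} \<alpha> \<and>
           (\<forall>t\<in>{0..1}. \<alpha> t \<in> NCstar G) \<and>
           \<alpha> 0 = A \<and> \<alpha> 1 = G \<and>
           (\<forall>B\<in>\<alpha> ` {0..1} - {G}. p \<notin> B)"
proof -
  obtain a where a: "a \<in> A" "A \<subseteq> G" using assms(3) by (auto simp: NCstar_def subcontinua_def)
  have "finite_graph G" using assms(1) by (simp add: tangle_def)
  then obtain V E where VE: "graph_decomposition G V E" "{p, a} \<subseteq> V"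
    using finite_graph_decomposition[of G "{p, a}"] assms(2) a by auto
  interpret graph_decomposition G V E by (rule VE)
  interpret partial_growth G V E A p a
    using assms a VE(2) by unfold_locales (auto simp: tangle_def cut_point_def)
  show ?thesis using growth_path by fastforce
qed

end
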